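(* Let $M,L,M',L'$ be positive integers, $N=M+L-1$, $N'=M'+L'-1$. Let $\mathbf{Y}_{N,N'}$ be an $N\times N'$ complex matrix, let $x(t,t')\in\mathbb{C}$ for $0\le t\le N-1$, $0\le t'\le N'-1$, and let $\omega,\omega'\in[0,2\pi)$. Consider the constrained optimization problem in the unknowns $\mathbf{h}\in\mathbb{C}^{M\times M'}$ (an $M\times M'$ complex matrix) and $\alpha\in\mathbb{C}$: $$\min_{\mathbf{h},\alpha}\ \sum_{t=0}^{L-1}\sum_{t'=0}^{L'-1}\left|\mathrm{vec}(\mathbf{h})^*\,\mathbf{y}_{t,t'}-\alpha\,x(t,t')e^{i(\omega t+\omega' t')}\right|^2\qquad\text{subject to}\qquad \mathrm{vec}(\mathbf{h})^*\,(\mathbf{x}_{M,M'}\circ\mathbf{a}_{M,M'}(\omega,\omega'))=1 .$$ Set $\|\mathbf{x}_{L,L'}\|^2=\sum_{t=0}^{L-1}\sum_{t'=0}^{L'-1}|x(t,t')|^2$, $$\mathbf{g}(\omega,\omega')=\frac{1}{\|\mathbf{x}_{L,L'}\|^2}\sum_{t=0}^{L-1}\sum_{t'=0}^{L'-1}x(t,t')^*e^{-i(\omega t+\omega' t')}\,\mathbf{y}_{t,t'},$$ $$\mathbf{Q}(\omega,\omega')=\frac{1}{\|\mathbf{x}_{L,L'}\|^2}\sum_{t=0}^{L-1}\sum_{t'=0}^{L'-1}\mathbf{y}_{t,t'}\,\mathbf{y}_{t,t'}^*-\mathbf{g}(\omega,\omega')\,\mathbf{g}(\omega,\omega')^* .$$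 Assume that the expressions below are well defined, i.e. $\mathbf{x}_{L,L'}\neq 0$, $\mathbf{Q}(\omega,\omega')$ is invertible, and the denominator below is nonzero. Then the minimum in the problem is attained at $(\mathbf{h},\alpha)=(\mathbf{h}_{NAPES}(\omega,\omega'),\alpha_{NAPES}(\omega,\omega'))$, where $$\mathrm{vec}(\mathbf{h}_{NAPES}(\omega,\omega'))=\frac{\mathbf{Q}(\omega,\omega')^{-1}(\mathbf{x}_{M,M'}\circ\mathbf{a}_{M,M'}(\omega,\omega'))}{(\mathbf{x}_{M,M'}\circ\mathbf{a}_{M,M'}(\omega,\omega'))^*\,\mathbf{Q}(\omega,\omega')^{-1}(\mathbf{x}_{M,M'}\circ\mathbf{a}_{M,M'}(\omega,\omega'))},$$ $$\alpha_{NAPES}(\omega,\omega')=\mathrm{vec}(\mathbf{h}_{NAPES}(\omega,\omega'))^*\,\mathbf{g}(\omega,\omega').$$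
   Context: For a complex number $z$, $z^*$ is its complex conjugate; for a complex matrix or vector $A$, $A^*$ is the conjugate transpose. $\circ$ is the Hadamard (entrywise) product, $\otimes$ the Kronecker product, and $\mathrm{vec}$ stacks the columns of a matrix into one column vector; $i^2=-1$. Rows and columns are numbered starting from $0$. $\mathbf{Y}_{N,N'}$ is the two-dimensional data array and $x(t,t')$ the known noise. For $0\le t\le L-1$, $0\le t'\le L'-1$, $\mathbf{y}_{t,t'}\in\mathbb{C}^{MM'}$ is the vectorization ($\mathrm{vec}$) of the $M\times M'$ submatrix of $\mathbf{Y}_{N,N'}$ formed by rows $t,\dots,t+M-1$ and columns $t',\dots,t'+M'-1$. For positive integers $P,P'$, $$\mathbf{a}_{P,P'}(\omega,\omega')=(1,e^{i\omega'},\dots,e^{i(P'-1)\omega'})^T\otimes(1,e^{i\omega},\dots,e^{i(P-1)\omega})^T\in\mathbb{C}^{PP'},$$ and for $P\le N$, $P'\le N'$, $\mathbf{x}_{P,P'}=(x(0,0),\dots,x(P-1,0),\dots,x(0,P'-1),\dots,x(P-1,P'-1))^T\in\mathbb{C}^{PP'}$. *)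

theory Defs
  imports
    Complex_Main
    Jordan_Normal_Form.Matrix
    Jordan_Normal_Form.Gauss_Jordan_Elimination
    Jordan_Normal_Form.DL_Submatrix
begin

text \<open>
  Rows, columns and vector entries are numbered from 0. For complex vectors the product
  \<open>v \<bullet>c w\<close> conjugates its second argument, so \<open>w\<^sup>* v\<close> is rendered as \<open>v \<bullet>c w\<close>.
\<close>

text \<open>Column stacking: entry \<open>(i, j)\<close> of \<open>A\<close> goes to position \<open>i + j * dim_row A\<close>.\<close>

definition vectorize :: "'a mat \<Rightarrow> 'a vec" where
  "vectorize A = vec (dim_row A * dim_col A)
     (\<lambda>k. A $$ (k mod dim_row A, k div dim_row A))"

definition unvectorize :: "nat \<Rightarrow> nat \<Rightarrow> 'a vec \<Rightarrow> 'a mat" where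
  "unvectorize m n v = mat m n (\<lambda>(i, j). v $ (i + j * m))"

lemma vectorize_carrier [simp]:
  "A \<in> carrier_mat m n \<Longrightarrow> vectorize A \<in> carrier_vec (m * n)"
  by (auto simp: vectorize_def)

lemma unvectorize_carrier [simp]: "unvectorize m n v \<in> carrier_mat m n"
  by (simp add: unvectorize_def)

lemma vectorize_unvectorize:
  assumes "v \<in> carrier_vec (m * n)"
  shows "vectorize (unvectorize m n v) = v"
proof (rule eq_vecI)
  fix k assume "k < dim_vec v"
  with assms have k: "k < m * n" by simp
  then have "m > 0" by (cases m) auto
  moreover have "k div m < n" using k by (simp add: less_mult_imp_div_less mult.commute)
  ultimately show "vectorize (unvectorize m n v) $ k = v $ k"
    using k by (simp add: vectorize_def unvectorize_def mod_div_mult_eq)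
qed (use assms in \<open>simp add: vectorize_def unvectorize_def\<close>)

lemma unvectorize_vectorize:
  assumes "A \<in> carrier_mat m n"
  shows "unvectorize m n (vectorize A) = A"
proof (rule eq_matI)
  fix i j assume "i < dim_row A" "j < dim_col A"
  with assms have ij: "i < m" "j < n" by auto
  have "i + j * m < m + j * m" using ij by simp
  also have "\<dots> = Suc j * m" by simp
  also have "\<dots> \<le> n * m" using ij by (intro mult_le_mono1) simp
  finally have "i + j * m < m * n" by (simp add: mult.commute)
  then show "unvectorize m n (vectorize A) $$ (i, j) = A $$ (i, j)"
    using ij assms by (simp add: vectorize_def unvectorize_def)
qed (use assms in \<open>simp_all add: unvectorize_def\<close>)

definition hadamard_vec :: "'a :: times vec \<Rightarrow> 'a vec \<Rightarrow> 'a vec" (infixl "\<circ>\<^sub>v" 70) where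
  "v \<circ>\<^sub>v w = vec (dim_vec v) (\<lambda>k. v $ k * w $ k)"

definition kronecker_vec :: "'a :: times vec \<Rightarrow> 'a vec \<Rightarrow> 'a vec" (infixl "\<otimes>\<^sub>v" 70) where
  "v \<otimes>\<^sub>v w = vec (dim_vec v * dim_vec w)
     (\<lambda>k. v $ (k div dim_vec w) * w $ (k mod dim_vec w))"

text \<open>The rank-one matrix \<open>v w\<^sup>*\<close>.\<close>

definition outer_prod :: "complex vec \<Rightarrow> complex vec \<Rightarrow> complex mat" where
  "outer_prod v w = mat (dim_vec v) (dim_vec w) (\<lambda>(i, j). v $ i * cnj (w $ j))"

definition sum_mats :: "nat \<Rightarrow> nat \<Rightarrow> ('b \<Rightarrow> complex mat) \<Rightarrow> 'b set \<Rightarrow> complex mat" where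
  "sum_mats m n = finsum (module_mat TYPE(complex) m n)"

lemma sum_mats_carrier_index:
  assumes "finite S" "\<And>s. s \<in> S \<Longrightarrow> F s \<in> carrier_mat m n"
  shows "sum_mats m n F S \<in> carrier_mat m n \<and>
    (\<forall>i<m. \<forall>j<n. sum_mats m n F S $$ (i, j) = (\<Sum>s\<in>S. F s $$ (i, j)))"
  using assms
proof (induction S rule: finite_induct)
  interpret abelian_group "module_mat TYPE(complex) m n" by (rule abelian_group_mat)
  case empty
  then show ?case unfolding sum_mats_def finsum_empty by (simp add: module_mat_simps)
next
  interpret abelian_group "module_mat TYPE(complex) m n" by (rule abelian_group_mat)
  case (insert x S)
  have F: "F \<in> S \<rightarrow> carrier (module_mat TYPE(complex) m n)"
    "F x \<in> carrier (module_mat TYPE(complex) m n)"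
    using insert.prems by (auto simp: module_mat_simps)
  have "sum_mats m n F (insert x S) = F x + sum_mats m n F S"
    unfolding sum_mats_def finsum_insert[OF insert.hyps F] by (simp add: module_mat_simps)
  with insert show ?case by auto
qed

text \<open>The vector \<open>y\<^bsub>t,t'\<^esub>\<close> of the data array \<open>Y\<close>, for subarrays of size \<open>M \<times> M'\<close>.\<close>

definition snapshot ::
    "complex mat \<Rightarrow> nat \<Rightarrow> nat \<Rightarrow> nat \<Rightarrow> nat \<Rightarrow> complex vec" where
  "snapshot Y M M' t t' = vectorize (submatrix Y {t..<t + M} {t'..<t' + M'})"

lemma snapshot_submatrix:
  assumes Y: "Y \<in> carrier_mat N N'" and le: "t + M \<le> N" "t' + M' \<le> N'"
  shows "submatrix Y {t..<t + M} {t'..<t' + M'} = mat M M' (\<lambda>(i, j). Y $$ (t + i, t' + j))"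
proof -
  have "{i. i < dim_row Y \<and> i \<in> {t..<t + M}} = {t..<t + M}"
    "{j. j < dim_col Y \<and> j \<in> {t'..<t' + M'}} = {t'..<t' + M'}"
    using Y le by auto
  moreover have pick: "pick {s..<s + m} i = s + i" if "i < m" for s m i
  proof -
    have "{a \<in> {s..<s + m}. a < s + i} = {s..<s + i}" using that by auto
    then show ?thesis using pick_card_in_set[of "s + i" "{s..<s + m}"] that by simp
  qed
  ultimately show ?thesis
    by (intro eq_matI) (simp_all add: submatrix_def pick)
qed

definition fourier_vec :: "nat \<Rightarrow> real \<Rightarrow> complex vec" where
  "fourier_vec P \<omega> = vec P (\<lambda>k. exp (\<i> * complex_of_real \<omega> * of_nat k))"

definition steering_vec :: "nat \<Rightarrow> nat \<Rightarrow> real \<Rightarrow> real \<Rightarrow> complex vec" where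
  "steering_vec P P' \<omega> \<omega>' = fourier_vec P' \<omega>' \<otimes>\<^sub>v fourier_vec P \<omega>"

definition noise_vec :: "(nat \<Rightarrow> nat \<Rightarrow> complex) \<Rightarrow> nat \<Rightarrow> nat \<Rightarrow> complex vec" where
  "noise_vec x P P' = vectorize (mat P P' (\<lambda>(t, t'). x t t'))"

definition noisy_steering_vec ::
    "(nat \<Rightarrow> nat \<Rightarrow> complex) \<Rightarrow> nat \<Rightarrow> nat \<Rightarrow> real \<Rightarrow> real \<Rightarrow> complex vec" where
  "noisy_steering_vec x M M' \<omega> \<omega>' = noise_vec x M M' \<circ>\<^sub>v steering_vec M M' \<omega> \<omega>'"

definition wave :: "real \<Rightarrow> real \<Rightarrow> nat \<Rightarrow> nat \<Rightarrow> complex" where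
  "wave \<omega> \<omega>' t t' = exp (\<i> * complex_of_real (\<omega> * real t + \<omega>' * real t'))"

definition napes_objective ::
    "complex mat \<Rightarrow> (nat \<Rightarrow> nat \<Rightarrow> complex) \<Rightarrow> nat \<Rightarrow> nat \<Rightarrow> nat \<Rightarrow> nat \<Rightarrow> real \<Rightarrow> real \<Rightarrow>
      complex mat \<Rightarrow> complex \<Rightarrow> real" where
  "napes_objective Y x M M' L L' \<omega> \<omega>' h \<alpha> =
     (\<Sum>t<L. \<Sum>t'<L'.
        (cmod (snapshot Y M M' t t' \<bullet>c vectorize h - \<alpha> * x t t' * wave \<omega> \<omega>' t t'))\<^sup>2)"

definition napes_feasible ::
    "(nat \<Rightarrow> nat \<Rightarrow> complex) \<Rightarrow> nat \<Rightarrow> nat \<Rightarrow> real \<Rightarrow> real \<Rightarrow> complex mat \<Rightarrow> bool" where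
  "napes_feasible x M M' \<omega> \<omega>' h \<longleftrightarrow>
     h \<in> carrier_mat M M' \<and> noisy_steering_vec x M M' \<omega> \<omega>' \<bullet>c vectorize h = 1"

definition noise_energy :: "(nat \<Rightarrow> nat \<Rightarrow> complex) \<Rightarrow> nat \<Rightarrow> nat \<Rightarrow> real" where
  "noise_energy x L L' = (\<Sum>t<L. \<Sum>t'<L'. (cmod (x t t'))\<^sup>2)"

definition napes_g ::
    "complex mat \<Rightarrow> (nat \<Rightarrow> nat \<Rightarrow> complex) \<Rightarrow> nat \<Rightarrow> nat \<Rightarrow> nat \<Rightarrow> nat \<Rightarrow> real \<Rightarrow> real \<Rightarrow>
      complex vec" where
  "napes_g Y x M M' L L' \<omega> \<omega>' =
     complex_of_real (1 / noise_energy x L L') \<cdot>\<^sub>v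
       finsum_vec TYPE(complex) (M * M')
         (\<lambda>(t, t'). (cnj (x t t') * exp (- \<i> * complex_of_real (\<omega> * real t + \<omega>' * real t')))
            \<cdot>\<^sub>v snapshot Y M M' t t')
         ({..<L} \<times> {..<L'})"

definition napes_Q ::
    "complex mat \<Rightarrow> (nat \<Rightarrow> nat \<Rightarrow> complex) \<Rightarrow> nat \<Rightarrow> nat \<Rightarrow> nat \<Rightarrow> nat \<Rightarrow> real \<Rightarrow> real \<Rightarrow>
      complex mat" where
  "napes_Q Y x M M' L L' \<omega> \<omega>' =
     complex_of_real (1 / noise_energy x L L') \<cdot>\<^sub>m
       sum_mats (M * M') (M * M')
         (\<lambda>(t, t'). outer_prod (snapshot Y M M' t t') (snapshot Y M M' t t'))
         ({..<L} \<times> {..<L'})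
     - outer_prod (napes_g Y x M M' L L' \<omega> \<omega>') (napes_g Y x M M' L L' \<omega> \<omega>')"

text \<open>
  The vector \<open>Q\<^sup>-\<^sup>1 (x \<circ> a)\<close> and the scalar \<open>(x \<circ> a)\<^sup>* Q\<^sup>-\<^sup>1 (x \<circ> a)\<close>. They are meaningful only
  for invertible \<open>Q\<close>, since \<open>mat_inverse\<close> is option-valued.
\<close>

definition napes_num ::
    "complex mat \<Rightarrow> (nat \<Rightarrow> nat \<Rightarrow> complex) \<Rightarrow> nat \<Rightarrow> nat \<Rightarrow> nat \<Rightarrow> nat \<Rightarrow> real \<Rightarrow> real \<Rightarrow>
      complex vec" where
  "napes_num Y x M M' L L' \<omega> \<omega>' =
     the (mat_inverse (napes_Q Y x M M' L L' \<omega> \<omega>')) *\<^sub>v noisy_steering_vec x M M' \<omega> \<omega>'"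

definition napes_den ::
    "complex mat \<Rightarrow> (nat \<Rightarrow> nat \<Rightarrow> complex) \<Rightarrow> nat \<Rightarrow> nat \<Rightarrow> nat \<Rightarrow> nat \<Rightarrow> real \<Rightarrow> real \<Rightarrow>
      complex" where
  "napes_den Y x M M' L L' \<omega> \<omega>' =
     napes_num Y x M M' L L' \<omega> \<omega>' \<bullet>c noisy_steering_vec x M M' \<omega> \<omega>'"

definition h_NAPES ::
    "complex mat \<Rightarrow> (nat \<Rightarrow> nat \<Rightarrow> complex) \<Rightarrow> nat \<Rightarrow> nat \<Rightarrow> nat \<Rightarrow> nat \<Rightarrow> real \<Rightarrow> real \<Rightarrow>
      complex mat" where
  "h_NAPES Y x M M' L L' \<omega> \<omega>' =
     unvectorize M M'
       ((1 / napes_den Y x M M' L L' \<omega> \<omega>') \<cdot>\<^sub>v napes_num Y x M M' L L' \<omega> \<omega>')"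

definition alpha_NAPES ::
    "complex mat \<Rightarrow> (nat \<Rightarrow> nat \<Rightarrow> complex) \<Rightarrow> nat \<Rightarrow> nat \<Rightarrow> nat \<Rightarrow> nat \<Rightarrow> real \<Rightarrow> real \<Rightarrow>
      complex" where
  "alpha_NAPES Y x M M' L L' \<omega> \<omega>' =
     napes_g Y x M M' L L' \<omega> \<omega>' \<bullet>c vectorize (h_NAPES Y x M M' L L' \<omega> \<omega>')"

end

theory Submission
  imports Defs
begin

text \<open>
  Let \<open>w\<^sub>0 = vec h\<^sub>N\<^sub>A\<^sub>P\<^sub>E\<^sub>S\<close> and let \<open>r\<^sub>0\<close> be the residual at the claimed minimizer. The choice of
  \<open>\<alpha>\<close> makes \<open>r\<^sub>0\<close> orthogonal to the modulated noise, and then the inner product of the filter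
  output of any \<open>w\<close> with \<open>r\<^sub>0\<close> is a positive multiple of \<open>w\<^sup>* Q w\<^sub>0\<close>. As \<open>Q w\<^sub>0\<close> is a multiple of
  \<open>x \<circ> a\<close>, this quantity is the same for all feasible \<open>w\<close>. Hence every feasible residual differs
  from \<open>r\<^sub>0\<close> by a vector orthogonal to \<open>r\<^sub>0\<close>, and Pythagoras gives the claim.
\<close>

text \<open>The hypothesis says that \<open>r' - r\<close> is orthogonal to \<open>r\<close>, so
  Pythagoras makes the energy of \<open>r'\<close> exceed that of \<open>r\<close> by the energy of
  \<open>r' - r\<close>. It is phrased as an equality of two inner products because in the
  application both are evaluated to the same constant.\<close>

lemma sum_cmod_power2_le_of_orthogonal:
  fixes r r' :: "'i \<Rightarrow> complex"
  assumes "(\<Sum>s\<in>S. r' s * cnj (r s)) = (\<Sum>s\<in>S. r s * cnj (r s))"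
  shows "(\<Sum>s\<in>S. (cmod (r s))\<^sup>2) \<le> (\<Sum>s\<in>S. (cmod (r' s))\<^sup>2)"
proof -
  \<comment> \<open>The term under \<open>Re\<close> is \<open>(u - v) * cnj v\<close>, the part
    whose sum the hypothesis kills.\<close>
  have expand: "(cmod u)\<^sup>2 = (cmod v)\<^sup>2 + (cmod (u - v))\<^sup>2 + 2 * Re (u * cnj v - v * cnj v)" for u v
    by (simp only: cmod_power2) (simp add: power2_eq_square algebra_simps)
  have "(\<Sum>s\<in>S. Re (r' s * cnj (r s) - r s * cnj (r s))) = 0"
    using assms by (simp only: Re_sum[symmetric] sum_subtractf) simp
  then have "(\<Sum>s\<in>S. (cmod (r' s))\<^sup>2) = (\<Sum>s\<in>S. (cmod (r s))\<^sup>2) + (\<Sum>s\<in>S. (cmod (r' s - r s))\<^sup>2)"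
    by (subst expand[of "r' s" "r s" for s]) (simp only: sum.distrib sum_distrib_left[symmetric] mult_zero_right add_0_right)
  then show ?thesis
    by (simp add: sum_nonneg)
qed

section \<open>Sesquilinear forms of matrices in coordinates, and inverses\<close>

lemma cscalar_prod_sum:
  assumes "w \<in> carrier_vec n"
  shows "v \<bullet>c w = (\<Sum>i<n. v $ i * cnj (w $ i))"
  using assms by (simp add: scalar_prod_def atLeast0LessThan)

text \<open>Matrices enter the argument only through their forms \<open>w^* A u\<close>. As double
  sums these are visibly additive in \<open>A\<close>, and for a rank-one \<open>A\<close> the sums
  over \<open>i\<close> and \<open>j\<close> separate.\<close>

lemma mult_mat_vec_cscalar_prod:
  assumes "A \<in> carrier_mat n n" "u \<in> carrier_vec n" "w \<in> carrier_vec n"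
  shows "(A *\<^sub>v u) \<bullet>c w = (\<Sum>i<n. \<Sum>j<n. A $$ (i, j) * u $ j * cnj (w $ i))"
  using assms
  by (subst cscalar_prod_sum[OF assms(3)])
    (auto simp: scalar_prod_def atLeast0LessThan sum_distrib_right intro!: sum.cong)

lemma outer_prod_cscalar_prod:
  assumes "y \<in> carrier_vec n" "z \<in> carrier_vec n" "u \<in> carrier_vec n" "w \<in> carrier_vec n"
  shows "(outer_prod y z *\<^sub>v u) \<bullet>c w = (y \<bullet>c w) * cnj (z \<bullet>c u)"
proof -
  have "outer_prod y z \<in> carrier_mat n n"
    using assms by (auto simp: outer_prod_def)
  then have "(outer_prod y z *\<^sub>v u) \<bullet>c w =
      (\<Sum>i<n. \<Sum>j<n. outer_prod y z $$ (i, j) * u $ j * cnj (w $ i))"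
    using assms by (intro mult_mat_vec_cscalar_prod)
  also have "\<dots> = (\<Sum>i<n. \<Sum>j<n. (y $ i * cnj (w $ i)) * (cnj (z $ j) * u $ j))"
    using assms by (intro sum.cong) (auto simp: outer_prod_def)
  also have "\<dots> = (y \<bullet>c w) * cnj (z \<bullet>c u)"
    using assms by (simp add: cscalar_prod_sum[where n = n] sum_product)
  finally show ?thesis .
qed

lemma sum_mats_cscalar_prod:
  assumes "finite S" "\<And>s. s \<in> S \<Longrightarrow> F s \<in> carrier_mat n n"
    and "u \<in> carrier_vec n" "w \<in> carrier_vec n"
  shows "(sum_mats n n F S *\<^sub>v u) \<bullet>c w = (\<Sum>s\<in>S. (F s *\<^sub>v u) \<bullet>c w)"
proof -
  note F = sum_mats_carrier_index[OF assms(1,2)]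
  have "(sum_mats n n F S *\<^sub>v u) \<bullet>c w =
      (\<Sum>i<n. \<Sum>j<n. \<Sum>s\<in>S. F s $$ (i, j) * u $ j * cnj (w $ i))"
    using F assms by (subst mult_mat_vec_cscalar_prod[where n = n]) (auto simp: sum_distrib_right)
  also have "\<dots> = (\<Sum>i<n. \<Sum>s\<in>S. \<Sum>j<n. F s $$ (i, j) * u $ j * cnj (w $ i))"
    by (intro sum.cong refl sum.swap)
  also have "\<dots> = (\<Sum>s\<in>S. \<Sum>i<n. \<Sum>j<n. F s $$ (i, j) * u $ j * cnj (w $ i))"
    by (rule sum.swap)
  also have "\<dots> = (\<Sum>s\<in>S. (F s *\<^sub>v u) \<bullet>c w)"
    using assms by (intro sum.cong) (simp_all add: mult_mat_vec_cscalar_prod[where n = n])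
  finally show ?thesis .
qed

lemma finsum_vec_cscalar_prod:
  fixes f :: "'i \<Rightarrow> complex vec"
  assumes "finite S" "\<And>s. s \<in> S \<Longrightarrow> f s \<in> carrier_vec n" "w \<in> carrier_vec n"
  shows "finsum_vec TYPE(complex) n f S \<bullet>c w = (\<Sum>s\<in>S. f s \<bullet>c w)"
proof -
  have "finsum_vec TYPE(complex) n f S \<bullet>c w = (\<Sum>i<n. \<Sum>s\<in>S. f s $ i * cnj (w $ i))"
    using assms by (simp add: cscalar_prod_sum[where n = n] index_finsum_vec sum_distrib_right)
  also have "\<dots> = (\<Sum>s\<in>S. f s \<bullet>c w)"
    using assms by (subst sum.swap) (simp add: cscalar_prod_sum[where n = n])
  finally show ?thesis .
qed

lemma mat_inverse_invertible:
  fixes A :: "'a :: field mat"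
  assumes A: "A \<in> carrier_mat n n" and inv: "invertible_mat A"
  shows "the (mat_inverse A) \<in> carrier_mat n n" "A * the (mat_inverse A) = 1\<^sub>m n"
proof -
  obtain B where B: "A * B = 1\<^sub>m n" "B * A = 1\<^sub>m (dim_row B)"
    using A inv by (auto simp: invertible_mat_def inverts_mat_def)
  \<comment> \<open>\<open>invertible_mat\<close> leaves the shape of \<open>B\<close> open;
    comparing column counts in the two equations of \<open>B\<close> makes it square of size
    \<open>n\<close>, so that \<open>A\<close> is a unit of the matrix ring and
    \<open>mat_inverse\<close> cannot return \<open>None\<close>.\<close>
  have "dim_col (A * B) = n" "dim_col (B * A) = dim_row B"
    unfolding B by simp_all
  then have "B \<in> carrier_mat n n"
    using A by auto
  then have "A \<in> Units (ring_mat TYPE('a) n ())"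
    using A B by (auto simp: Units_def ring_mat_simps)
  then obtain C where C: "mat_inverse A = Some C"
    using mat_inverse(1)[OF A, of "()"] by (cases "mat_inverse A") auto
  from mat_inverse(2)[OF A C] C
  show "the (mat_inverse A) \<in> carrier_mat n n" "A * the (mat_inverse A) = 1\<^sub>m n"
    by simp_all
qed

section \<open>Dimensions, noise energy and the modulating wave\<close>

lemma snapshot_carrier:
  assumes "Y \<in> carrier_mat N N'" "t + M \<le> N" "t' + M' \<le> N'"
  shows "snapshot Y M M' t t' \<in> carrier_vec (M * M')"
  unfolding snapshot_def snapshot_submatrix[OF assms] by simp

lemma noisy_steering_vec_carrier:
  "noisy_steering_vec x M M' \<omega> \<omega>' \<in> carrier_vec (M * M')"
  by (auto simp: noisy_steering_vec_def noise_vec_def hadamard_vec_def vectorize_def)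

lemma noise_energy_eq_0_iff: "noise_energy x L L' = 0 \<longleftrightarrow> (\<forall>t<L. \<forall>t'<L'. x t t' = 0)"
  by (simp add: noise_energy_def sum_nonneg_eq_0_iff sum_nonneg Ball_def)

lemma noise_energy_neq_0:
  assumes "noise_vec x L L' \<noteq> 0\<^sub>v (L * L')"
  shows "noise_energy x L L' \<noteq> 0"
proof
  assume 0: "noise_energy x L L' = 0"
  have "noise_vec x L L' = 0\<^sub>v (L * L')"
  proof (rule eq_vecI)
    fix k assume "k < dim_vec (0\<^sub>v (L * L') :: complex vec)"
    then have k: "k < L * L'" by simp
    then have "L > 0" by (cases L) auto
    moreover have "k div L < L'" using k by (simp add: less_mult_imp_div_less mult.commute)
    ultimately show "noise_vec x L L' $ k = 0\<^sub>v (L * L') $ k"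
      using k 0 by (simp add: noise_vec_def vectorize_def noise_energy_eq_0_iff)
  qed (simp add: noise_vec_def vectorize_def)
  with assms show False ..
qed

lemma cmod_wave [simp]: "cmod (wave \<omega> \<omega>' t t') = 1"
  by (simp add: wave_def cis_conv_exp[symmetric])

lemma cnj_wave: "cnj (wave \<omega> \<omega>' t t') = exp (- \<i> * complex_of_real (\<omega> * real t + \<omega>' * real t'))"
  by (simp only: wave_def cis_conv_exp[symmetric] cis_cnj)
    (simp add: cis_conv_exp algebra_simps)

section \<open>First and second moments of the snapshots for fixed data\<close>

context
  fixes M M' L L' N N' :: nat
    and Y :: "complex mat"
    and x :: "nat \<Rightarrow> nat \<Rightarrow> complex"
    and \<omega> \<omega>' :: real
    and n E S y c g Q a
  defines "n \<equiv> M * M'"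
    and "E \<equiv> complex_of_real (noise_energy x L L')"
    and "S \<equiv> {..<L} \<times> {..<L'}"
    and "y \<equiv> \<lambda>(t, t'). snapshot Y M M' t t'"
    and "c \<equiv> \<lambda>(t, t'). x t t' * wave \<omega> \<omega>' t t'"
    and "g \<equiv> napes_g Y x M M' L L' \<omega> \<omega>'"
    and "Q \<equiv> napes_Q Y x M M' L L' \<omega> \<omega>'"
    and "a \<equiv> noisy_steering_vec x M M' \<omega> \<omega>'"
  assumes N: "N = M + L - 1" "N' = M' + L' - 1"
    and Y: "Y \<in> carrier_mat N N'"
    and x: "noise_vec x L L' \<noteq> 0\<^sub>v (L * L')"
begin

lemma y_carrier: "s \<in> S \<Longrightarrow> y s \<in> carrier_vec n"
  \<comment> \<open>For t < L the last row of the window satisfies t + M - 1 < M + L - 1 = N, and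
    likewise for columns, so every window indexed by \<open>S\<close> fits inside
    \<open>Y\<close>.\<close>
  using Y N unfolding y_def S_def n_def by (auto intro!: snapshot_carrier)

lemma finite_S: "finite S"
  by (simp add: S_def)

lemma E_neq_0: "E \<noteq> 0"
  using noise_energy_neq_0[OF x] by (simp add: E_def)

text \<open>The wave has modulus 1, so modulating the noise preserves its energy.\<close>

lemma sum_c_cnj_c: "(\<Sum>s\<in>S. c s * cnj (c s)) = E"
proof -
  have "(\<Sum>s\<in>S. c s * cnj (c s)) = (\<Sum>s\<in>S. complex_of_real ((cmod (c s))\<^sup>2))"
    by (simp only: complex_norm_square)
  also have "\<dots> = E"
    by (simp add: E_def noise_energy_def S_def c_def sum.cartesian_product norm_mult case_prod_unfold)
  finally show ?thesis .
qed

lemma g_eq: "g = (1 / E) \<cdot>\<^sub>v finsum_vec TYPE(complex) n (\<lambda>s. cnj (c s) \<cdot>\<^sub>v y s) S"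
  by (simp add: g_def napes_g_def E_def n_def S_def c_def y_def cnj_wave case_prod_unfold)

lemma g_carrier: "g \<in> carrier_vec n"
  unfolding g_eq using y_carrier by (auto intro!: finsum_vec_closed)

text \<open>The right side is the inner product of the filter output of \<open>w\<close> with
  \<open>c\<close>. As \<open>E\<close> is the squared norm of \<open>c\<close>, this identifies
  \<open>g \<bullet>c w\<close> as the least-squares coefficient of that output along
  \<open>c\<close>.\<close>

lemma g_cscalar_prod:
  assumes w: "w \<in> carrier_vec n"
  shows "E * (g \<bullet>c w) = (\<Sum>s\<in>S. (y s \<bullet>c w) * cnj (c s))"
proof -
  let ?v = "finsum_vec TYPE(complex) n (\<lambda>s. cnj (c s) \<cdot>\<^sub>v y s) S"
  have v: "?v \<in> carrier_vec n"
    using y_carrier by (intro finsum_vec_closed) auto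
  have "E * (g \<bullet>c w) = ?v \<bullet>c w"
    unfolding g_eq using v w E_neq_0 by (subst smult_scalar_prod_distrib[where n = n]) auto
  also have "\<dots> = (\<Sum>s\<in>S. (cnj (c s) \<cdot>\<^sub>v y s) \<bullet>c w)"
    using y_carrier w by (intro finsum_vec_cscalar_prod finite_S) auto
  also have "\<dots> = (\<Sum>s\<in>S. (y s \<bullet>c w) * cnj (c s))"
    using y_carrier w by (intro sum.cong refl) (simp add: smult_scalar_prod_distrib[where n = n])
  finally show ?thesis .
qed

lemma Q_eq: "Q = (1 / E) \<cdot>\<^sub>m sum_mats n n (\<lambda>s. outer_prod (y s) (y s)) S - outer_prod g g"
  by (simp add: Q_def napes_Q_def g_def E_def n_def S_def y_def case_prod_unfold)

lemma outer_prod_y_carrier: "s \<in> S \<Longrightarrow> outer_prod (y s) (y s) \<in> carrier_mat n n"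
  using y_carrier[of s] by (auto simp: outer_prod_def)

lemma Q_carrier: "Q \<in> carrier_mat n n"
  unfolding Q_eq using g_carrier by (auto simp: outer_prod_def)

text \<open>Up to the factor \<open>E\<close>, the form of \<open>Q\<close> is the inner product of
  the filter outputs of \<open>w\<close> and \<open>u\<close> minus that of their projections onto
  the line spanned by \<open>c\<close>.\<close>

lemma Q_cscalar_prod:
  assumes u: "u \<in> carrier_vec n" and w: "w \<in> carrier_vec n"
  shows "E * ((Q *\<^sub>v u) \<bullet>c w) =
    (\<Sum>s\<in>S. (y s \<bullet>c w) * cnj (y s \<bullet>c u)) - E * ((g \<bullet>c w) * cnj (g \<bullet>c u))"
proof -
  let ?R = "sum_mats n n (\<lambda>s. outer_prod (y s) (y s)) S"
  have R: "?R \<in> carrier_mat n n"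
    using sum_mats_carrier_index[OF finite_S outer_prod_y_carrier] by simp
  have G: "outer_prod g g \<in> carrier_mat n n"
    using g_carrier by (auto simp: outer_prod_def)
  have "(Q *\<^sub>v u) \<bullet>c w =
      (\<Sum>i<n. \<Sum>j<n. ((1 / E) * ?R $$ (i, j) - outer_prod g g $$ (i, j)) * u $ j * cnj (w $ i))"
    using R G by (subst mult_mat_vec_cscalar_prod[OF Q_carrier u w]) (simp add: Q_eq)
  also have "\<dots> = (1 / E) * ((?R *\<^sub>v u) \<bullet>c w) - (outer_prod g g *\<^sub>v u) \<bullet>c w"
    by (simp only: mult_mat_vec_cscalar_prod[OF R u w] mult_mat_vec_cscalar_prod[OF G u w]
        left_diff_distrib sum_subtractf sum_distrib_left mult.assoc)
  also have "(?R *\<^sub>v u) \<bullet>c w = (\<Sum>s\<in>S. (y s \<bullet>c w) * cnj (y s \<bullet>c u))"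
    using y_carrier u w
    by (simp add: sum_mats_cscalar_prod[OF finite_S outer_prod_y_carrier]
        outer_prod_cscalar_prod[where n = n])
  also have "(outer_prod g g *\<^sub>v u) \<bullet>c w = (g \<bullet>c w) * cnj (g \<bullet>c u)"
    using g_carrier u w by (intro outer_prod_cscalar_prod)
  finally show ?thesis
    using E_neq_0 by (simp add: right_diff_distrib)
qed

section \<open>Residuals and minimality\<close>

definition residual :: "complex vec \<Rightarrow> complex \<Rightarrow> nat \<times> nat \<Rightarrow> complex" where
  "residual w \<alpha> s = y s \<bullet>c w - \<alpha> * c s"

lemma napes_objective_eq:
  "napes_objective Y x M M' L L' \<omega> \<omega>' h \<alpha> = (\<Sum>s\<in>S. (cmod (residual (vectorize h) \<alpha> s))\<^sup>2)"
  by (simp add: napes_objective_def residual_def S_def y_def c_def sum.cartesian_product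
      case_prod_unfold mult.assoc)

text \<open>With the coefficient \<open>g \<bullet>c u\<close> the second residual is the filter
  output of \<open>u\<close> minus its projection onto \<open>c\<close>, hence orthogonal to
  \<open>c\<close>. The two terms containing \<open>\<alpha>\<close> therefore cancel, and what is
  left is the form of \<open>Q\<close>.\<close>

lemma residual_inner:
  assumes u: "u \<in> carrier_vec n" and w: "w \<in> carrier_vec n"
  shows "(\<Sum>s\<in>S. residual w \<alpha> s * cnj (residual u (g \<bullet>c u) s)) = E * ((Q *\<^sub>v u) \<bullet>c w)"
proof -
  let ?\<beta> = "g \<bullet>c u"
  \<comment> \<open>This is the conjugate of \<open>g_cscalar_prod\<close>; \<open>E\<close> is real
    and so unchanged.\<close>
  have gu: "(\<Sum>s\<in>S. cnj (y s \<bullet>c u) * c s) = E * cnj ?\<beta>"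
    using arg_cong[OF g_cscalar_prod[OF u], of cnj] by (simp add: E_def)
  have "(\<Sum>s\<in>S. residual w \<alpha> s * cnj (residual u ?\<beta> s)) =
      (\<Sum>s\<in>S. (y s \<bullet>c w) * cnj (y s \<bullet>c u) - cnj ?\<beta> * ((y s \<bullet>c w) * cnj (c s))
        - \<alpha> * (cnj (y s \<bullet>c u) * c s) + \<alpha> * cnj ?\<beta> * (c s * cnj (c s)))"
    by (intro sum.cong refl) (simp add: residual_def algebra_simps)
  also have "\<dots> = (\<Sum>s\<in>S. (y s \<bullet>c w) * cnj (y s \<bullet>c u)) - cnj ?\<beta> * (E * (g \<bullet>c w))
        - \<alpha> * (E * cnj ?\<beta>) + \<alpha> * cnj ?\<beta> * E"
    by (simp only: sum.distrib sum_subtractf sum_distrib_left[symmetric] gu sum_c_cnj_c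
        g_cscalar_prod[OF w])
  also have "\<dots> = E * ((Q *\<^sub>v u) \<bullet>c w)"
    by (simp add: Q_cscalar_prod[OF u w] algebra_simps)
  finally show ?thesis .
qed

lemma is_arg_min_NAPES:
  assumes inv: "invertible_mat Q" and den: "napes_den Y x M M' L L' \<omega> \<omega>' \<noteq> 0"
  shows "is_arg_min
    (\<lambda>(h, \<alpha>). napes_objective Y x M M' L L' \<omega> \<omega>' h \<alpha>)
    (\<lambda>(h, \<alpha>). napes_feasible x M M' \<omega> \<omega>' h)
    (h_NAPES Y x M M' L L' \<omega> \<omega>', alpha_NAPES Y x M M' L L' \<omega> \<omega>')"
proof -
  let ?h = "h_NAPES Y x M M' L L' \<omega> \<omega>'"
  define d where "d = napes_den Y x M M' L L' \<omega> \<omega>'"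
  define p where "p = napes_num Y x M M' L L' \<omega> \<omega>'"
  define u where "u = (1 / d) \<cdot>\<^sub>v p"
  have a: "a \<in> carrier_vec n"
    unfolding a_def n_def by (rule noisy_steering_vec_carrier)
  have p_eq: "p = the (mat_inverse Q) *\<^sub>v a"
    by (simp add: p_def napes_num_def Q_def a_def)
  note Qi = mat_inverse_invertible[OF Q_carrier inv]
  have p: "p \<in> carrier_vec n"
    unfolding p_eq using Qi(1) a by simp
  have u: "u \<in> carrier_vec n"
    using p by (simp add: u_def)
  have d: "d = p \<bullet>c a"
    by (simp add: d_def napes_den_def p_def a_def)
  have "Q *\<^sub>v p = a"
    unfolding p_eq using assoc_mult_mat_vec[OF Q_carrier Qi(1) a] Qi(2) a by simp
  then have Qu: "Q *\<^sub>v u = (1 / d) \<cdot>\<^sub>v a"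
    using mult_mat_vec[OF Q_carrier p] by (simp add: u_def)
  have vec_h: "vectorize ?h = u"
    using u unfolding h_NAPES_def u_def d_def p_def n_def by (simp add: vectorize_unvectorize)
  have alpha: "alpha_NAPES Y x M M' L L' \<omega> \<omega>' = g \<bullet>c u"
    by (simp add: alpha_NAPES_def vec_h g_def)
  have ua: "u \<bullet>c a = 1"
    using den p a by (simp add: u_def d[symmetric] smult_scalar_prod_distrib[where n = n])
      (simp add: d_def)
  \<comment> \<open>Dividing by \<open>d\<close> normalizes \<open>u \<bullet>c a\<close>, whereas
    the constraint concerns \<open>a \<bullet>c u\<close>. Since 1 is its own conjugate, the passage
    does not require knowing that \<open>d\<close> is real.\<close>
  have "a \<bullet>c u = cnj (u \<bullet>c a)"
    using a u by (simp add: cscalar_prod_sum[where n = n] mult.commute)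
  with ua have au: "a \<bullet>c u = 1"
    by simp
  \<comment> \<open>\<open>Q *\<^sub>v u\<close> is \<open>a\<close> scaled by \<open>1 / d\<close>,
    so the constraint alone determines the value. It applies to any feasible filter with any
    \<open>\<alpha>\<close>, and also to \<open>u\<close> with \<open>g \<bullet>c u\<close>, which
    supplies both sides of the orthogonality hypothesis.\<close>
  have const: "(\<Sum>s\<in>S. residual w \<alpha> s * cnj (residual u (g \<bullet>c u) s)) = E / d"
    if "w \<in> carrier_vec n" "a \<bullet>c w = 1" for w \<alpha>
    using that a by (simp add: residual_inner[OF u] Qu smult_scalar_prod_distrib[where n = n])
  have "napes_feasible x M M' \<omega> \<omega>' ?h"
    using au by (simp add: napes_feasible_def vec_h a_def) (simp add: h_NAPES_def)
  moreover have "napes_objective Y x M M' L L' \<omega> \<omega>' ?h (g \<bullet>c u) \<le>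
      napes_objective Y x M M' L L' \<omega> \<omega>' h \<alpha>" if "napes_feasible x M M' \<omega> \<omega>' h" for h \<alpha>
  proof -
    have w: "vectorize h \<in> carrier_vec n" "a \<bullet>c vectorize h = 1"
      using that by (auto simp: napes_feasible_def n_def a_def)
    show ?thesis
      unfolding napes_objective_eq vec_h
      by (rule sum_cmod_power2_le_of_orthogonal) (simp only: const[OF w] const[OF u au])
  qed
  ultimately show ?thesis
    unfolding alpha by (fastforce simp: is_arg_min_linorder)
qed

end

theorem proposition2:
  fixes M M' L L' N N' :: nat
    and Y :: "complex mat"
    and x :: "nat \<Rightarrow> nat \<Rightarrow> complex"
    and \<omega> \<omega>' :: real
  assumes "M > 0" "L > 0" "M' > 0" "L' > 0"
    and "N = M + L - 1" "N' = M' + L' - 1"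
    and "Y \<in> carrier_mat N N'"
    and "0 \<le> \<omega>" "\<omega> < 2 * pi" "0 \<le> \<omega>'" "\<omega>' < 2 * pi"
    and "noise_vec x L L' \<noteq> 0\<^sub>v (L * L')"
    and "invertible_mat (napes_Q Y x M M' L L' \<omega> \<omega>')"
    and "napes_den Y x M M' L L' \<omega> \<omega>' \<noteq> 0"
  shows "is_arg_min
    (\<lambda>(h, \<alpha>). napes_objective Y x M M' L L' \<omega> \<omega>' h \<alpha>)
    (\<lambda>(h, \<alpha>). napes_feasible x M M' \<omega> \<omega>' h)
    (h_NAPES Y x M M' L L' \<omega> \<omega>', alpha_NAPES Y x M M' L L' \<omega> \<omega>')"
  using is_arg_min_NAPES[OF assms(5,6,7,12,13,14)] .

end
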